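(* Consider the stochastic direct-search algorithm described in the context, with $q>1$. Suppose that for some $\varepsilon_q>0$ (independent of $k$), for every $k$ and every $\alpha>0$, almost surely $$\mathbb{P}\left(|F_k-F_k^g-(f(X_k)-f(X_k+\Delta_kG_k))|\ge \alpha\Delta_k^q \,\middle|\, \mathcal{F}_{k-1}\right)\le \frac{\varepsilon_q}{\alpha^{q/(q-1)}} ,$$ and that $$\theta>\frac{\varepsilon_q^{1/r(q)}\,\bar\tau_q}{\tau_q^-},\qquad r(q)=\frac{q}{q-1}.$$ Then $\sum_{k\in\mathbb{N}_0}\mathbb{E}[\Delta_k^q]<\infty$.
   Context: $f:\mathbb{R}^n\to\mathbb{R}$ is locally Lipschitz continuous (possibly non-smooth) with $\inf f=f^*\in\mathbb{R}$. Stochastic direct-search algorithm. Parameters: deterministic $x_0\in\mathbb{R}^n$, $\delta_0>0$, and $\theta>0$, $q>1$, $\tau\in(0,1)$, $\bar\tau\in[1,1+\tau]$. Set $X_0=x_0$, $\Delta_0=\delta_0$. For $k=0,1,\dots$: select a (random) direction $G_k$ in the unit sphere of $\mathbb{R}^n$; compute random estimates $F_k$ and $F_k^g$ of $f(X_k)$ and $f(X_k+\Delta_kG_k)$; if $F_k-F_k^g\ge\theta\Delta_k^q$ (successful iteration), set $X_{k+1}=X_k+\Delta_kG_k$ and $\Delta_{k+1}=\bar\tau\Delta_k$; otherwise (unsuccessful iteration) set $X_{k+1}=X_k$ and $\Delta_{k+1}=(1-\tau)\Delta_k$. $\mathcal{F}_{k-1}$ is the $\sigma$-algebra generated by $(F_j,F_j^g)_{j=0}^{k-1}$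 and $(G_j)_{j=0}^{k}$. Constants: $\tau_q^+=(1+\tau)^q-1$, $\tau_q^-=1-(1-\tau)^q$, $\bar\tau_q=\tau_q^++\tau_q^-$. *)

theory Defs
  imports "HOL-Probability.Probability"
begin

definition locally_lipschitz :: "('a::metric_space \<Rightarrow> 'b::metric_space) \<Rightarrow> bool" where
  "locally_lipschitz f \<longleftrightarrow> (\<forall>x. \<exists>u>0. \<exists>L. L-lipschitz_on (ball x u) f)"

text \<open>
  In the following locale, the objective function enters the algorithm only through the
  estimates \<open>F k\<close> and \<open>Fg k\<close> of its values at \<open>X k\<close> and at \<open>X k + \<Delta> k *\<^sub>R G k\<close>,
  so it is not a parameter; the accuracy of the estimates is a separate hypothesis.
\<close>

locale stochastic_direct_search = prob_space M
  for M :: "'w measure" +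
  fixes x0 :: "real ^ 'n"
    and \<delta>0 \<theta> q \<tau> \<tau>bar :: real
    and G :: "nat \<Rightarrow> 'w \<Rightarrow> real ^ 'n"
    and F Fg :: "nat \<Rightarrow> 'w \<Rightarrow> real"
    and X :: "nat \<Rightarrow> 'w \<Rightarrow> real ^ 'n"
    and \<Delta> :: "nat \<Rightarrow> 'w \<Rightarrow> real"
  assumes \<delta>0_pos: "0 < \<delta>0"
    and \<theta>_pos: "0 < \<theta>"
    and q_gt_1: "1 < q"
    and \<tau>_range: "\<tau> \<in> {0<..<1}"
    and \<tau>bar_range: "\<tau>bar \<in> {1..1 + \<tau>}"
    and G_measurable: "\<And>k. random_variable borel (G k)"
    and F_measurable: "\<And>k. random_variable borel (F k)"
    and Fg_measurable: "\<And>k. random_variable borel (Fg k)"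
    and G_sphere: "\<And>k \<omega>. \<omega> \<in> space M \<Longrightarrow> G k \<omega> \<in> sphere 0 1"
    and X_0: "\<And>\<omega>. \<omega> \<in> space M \<Longrightarrow> X 0 \<omega> = x0"
    and \<Delta>_0: "\<And>\<omega>. \<omega> \<in> space M \<Longrightarrow> \<Delta> 0 \<omega> = \<delta>0"
    and X_Suc: "\<And>k \<omega>. \<omega> \<in> space M \<Longrightarrow>
      X (Suc k) \<omega> = (if F k \<omega> - Fg k \<omega> \<ge> \<theta> * \<Delta> k \<omega> powr q
                     then X k \<omega> + \<Delta> k \<omega> *\<^sub>R G k \<omega> else X k \<omega>)"
    and \<Delta>_Suc: "\<And>k \<omega>. \<omega> \<in> space M \<Longrightarrow>
      \<Delta> (Suc k) \<omega> = (if F k \<omega> - Fg k \<omega> \<ge> \<theta> * \<Delta> k \<omega> powr q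
                     then \<tau>bar * \<Delta> k \<omega> else (1 - \<tau>) * \<Delta> k \<omega>)"

text \<open>
  \<open>history M G F Fg k\<close> is the \<open>\<sigma>\<close>-algebra \<open>\<F>\<close> with index \<open>k - 1\<close>, generated by the estimates of
  iterations \<open>0, \<dots>, k - 1\<close> and the directions of iterations \<open>0, \<dots>, k\<close>. The index is
  shifted so that \<open>k = 0\<close> (only the direction \<open>G 0\<close> is known) is covered.
\<close>

definition history ::
  "'w measure \<Rightarrow> (nat \<Rightarrow> 'w \<Rightarrow> 'v::topological_space) \<Rightarrow> (nat \<Rightarrow> 'w \<Rightarrow> real) \<Rightarrow>
   (nat \<Rightarrow> 'w \<Rightarrow> real) \<Rightarrow> nat \<Rightarrow> 'w measure" where
  "history M G F Fg k = sigma (space M)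
     ({F j -` A \<inter> space M | j A. j < k \<and> A \<in> sets borel} \<union>
      {Fg j -` A \<inter> space M | j A. j < k \<and> A \<in> sets borel} \<union>
      {G j -` A \<inter> space M | j A. j \<le> k \<and> A \<in> sets borel})"

definition tau_plus :: "real \<Rightarrow> real \<Rightarrow> real" where
  "tau_plus \<tau> q = (1 + \<tau>) powr q - 1"

definition tau_minus :: "real \<Rightarrow> real \<Rightarrow> real" where
  "tau_minus \<tau> q = 1 - (1 - \<tau>) powr q"

definition tau_total :: "real \<Rightarrow> real \<Rightarrow> real" where
  "tau_total \<tau> q = tau_plus \<tau> q + tau_minus \<tau> q"

definition conj_exponent :: "real \<Rightarrow> real" where
  "conj_exponent q = q / (q - 1)"

end

theory Submission
  imports Defs
begin

text \<open>
  The proof is a Lyapunov argument. Put \<open>\<nu> = \<theta> / tau_total \<tau> q\<close> and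
  \<open>\<Phi>\<^sub>k = f (X\<^sub>k) + \<nu> \<Delta>\<^sub>k\<^sup>q\<close>, which is bounded below by \<open>inf f\<close>. An unsuccessful iteration
  changes \<open>\<Phi>\<close> by \<open>- \<nu> tau_minus \<Delta>\<^sub>k\<^sup>q\<close>; a successful one changes it by at most
  \<open>Y\<^sub>k - \<nu> tau_minus \<Delta>\<^sub>k\<^sup>q\<close> with \<open>Y\<^sub>k = \<theta> \<Delta>\<^sub>k\<^sup>q - D\<^sub>k\<close>,
  where \<open>D\<^sub>k = f (X\<^sub>k) - f (X\<^sub>k + \<Delta>\<^sub>k G\<^sub>k)\<close> is the true decrease.
  The value of \<open>\<nu>\<close> is the one for which this surplus \<open>Y\<^sub>k\<close> is also a threshold for the estimation
  error: an iteration is accepted only if \<open>F\<^sub>k - F\<^sub>k\<^sup>g - D\<^sub>k \<ge> Y\<^sub>k\<close>. So if \<open>p\<close> is the conditional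
  probability of success, a large \<open>Y\<^sub>k\<close> forces a small \<open>p\<close> by the tail condition, and the
  product satisfies \<open>p Y\<^sub>k \<le> \<epsilon>\<^bsup>1/r\<^esup> \<Delta>\<^sub>k\<^sup>q\<close> whatever the size of \<open>Y\<^sub>k\<close>
  (lemma \<open>cond_prob_times_threshold_le\<close>).

  Hence \<open>\<Phi>\<close> decreases in expectation by at least
  \<open>(\<nu> tau_minus - \<epsilon>\<^bsup>1/r\<^esup>) E \<Delta>\<^sub>k\<^sup>q\<close>, and the hypothesis on \<open>\<theta>\<close> says precisely that this
  factor is positive. Telescoping bounds the partial sums of \<open>E \<Delta>\<^sub>k\<^sup>q\<close>. Integrability
  holds because, for fixed \<open>k\<close>, the step sizes and hence the iterates stay in a deterministic
  bounded set, on which the continuous function \<open>f\<close> is bounded.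
\<close>

section \<open>Conditional tail bounds at a random threshold\<close>

text \<open>
  Two bounds on \<open>p\<close> are available, \<open>1\<close> and \<open>\<epsilon> / \<alpha>\<^sup>r\<close>; they cross at \<open>\<alpha> = \<epsilon>\<^bsup>1/r\<^esup>\<close>,
  where \<open>p * \<alpha>\<close> is largest.
\<close>

lemma tail_bound_times_level_le:
  fixes p \<alpha> \<epsilon> r :: real
  assumes "0 < \<epsilon>" "0 < \<alpha>" "1 \<le> r" "p \<le> 1" "p \<le> \<epsilon> / \<alpha> powr r"
  shows "p * \<alpha> \<le> \<epsilon> powr (1 / r)"
proof (cases "\<alpha> \<le> \<epsilon> powr (1 / r)")
  case True
  have "p * \<alpha> \<le> 1 * \<alpha>" using assms by (intro mult_right_mono) auto
  then show ?thesis using True by simp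
next
  case False
  define \<kappa> where "\<kappa> = \<epsilon> powr (1 / r)"
  have \<kappa>: "0 < \<kappa>" "\<kappa> < \<alpha>" "\<epsilon> = \<kappa> powr r"
    using False assms by (auto simp: \<kappa>_def powr_powr)
  have "p \<le> (\<kappa> / \<alpha>) powr r" using assms \<kappa> by (simp add: powr_divide)
  also have "\<dots> \<le> (\<kappa> / \<alpha>) powr 1"
    using \<kappa> assms by (intro powr_mono') auto
  also have "\<dots> = \<kappa> / \<alpha>" using \<kappa> assms by simp
  finally show ?thesis using assms by (simp add: \<kappa>_def field_simps)
qed

text \<open>
  The tail condition is available, outside a null set depending on the level, for each constant
  level \<open>\<alpha>\<close>, whereas the threshold \<open>Y / W\<close> is random. Rational levels suffice: there are
  countably many, so the exceptional sets can be discarded together, and since the event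
  \<open>\<alpha> W \<le> Y\<close> lies in the sub-\<open>\<sigma>\<close>-algebra, its
  indicator can be pulled out of the conditional expectation.
  A random threshold is then approximated by rationals from below.
\<close>

lemma (in finite_measure_subalgebra) cond_prob_times_threshold_le:
  fixes e W Y :: "'a \<Rightarrow> real" and \<epsilon> r :: real
  assumes [measurable]: "e \<in> borel_measurable M" "S \<in> sets M"
    and FW [measurable]: "W \<in> borel_measurable F"
    and FY [measurable]: "Y \<in> borel_measurable F"
    and Wpos: "\<And>\<omega>. \<omega> \<in> space M \<Longrightarrow> 0 < W \<omega>"
    and S: "\<And>\<omega>. \<omega> \<in> S \<Longrightarrow> Y \<omega> \<le> \<bar>e \<omega>\<bar>"
    and "0 < \<epsilon>" "1 \<le> r"
    and tail: "\<And>\<alpha>. 0 < \<alpha> \<Longrightarrow> AE \<omega> in M.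
      real_cond_exp M F (indicat_real {\<omega> \<in> space M. \<bar>e \<omega>\<bar> \<ge> \<alpha> * W \<omega>}) \<omega> \<le> \<epsilon> / \<alpha> powr r"
  shows "AE \<omega> in M. real_cond_exp M F (indicat_real S) \<omega> * Y \<omega> \<le> \<epsilon> powr (1 / r) * W \<omega>"
proof -
  define p where "p = real_cond_exp M F (indicat_real S)"
  have WM [measurable]: "W \<in> borel_measurable M" and YM [measurable]: "Y \<in> borel_measurable M"
    using measurable_from_subalg[OF subalg] FW FY by blast+
  have intS: "integrable M (indicat_real S)"
    by (intro integrable_real_indicator) (auto simp: less_top[symmetric])
  have p_nonneg: "AE \<omega> in M. 0 \<le> p \<omega>"
    unfolding p_def by (intro real_cond_exp_pos) auto
  have p_le_1: "AE \<omega> in M. p \<omega> \<le> 1"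
    unfolding p_def using intS by (intro real_cond_exp_le_c) (auto simp: indicator_def)
  have level: "AE \<omega> in M. \<alpha> * W \<omega> \<le> Y \<omega> \<longrightarrow> p \<omega> \<le> \<epsilon> / \<alpha> powr r" if "0 < \<alpha>" for \<alpha> :: real
  proof -
    define C where "C = {\<omega> \<in> space M. \<alpha> * W \<omega> \<le> Y \<omega>}"
    define B where "B = {\<omega> \<in> space M. \<bar>e \<omega>\<bar> \<ge> \<alpha> * W \<omega>}"
    have "C = {\<omega> \<in> space F. \<alpha> * W \<omega> \<le> Y \<omega>}"
      using subalg by (simp add: C_def subalgebra_def)
    then have CF [measurable]: "C \<in> sets F" by simp
    then have CM [measurable]: "C \<in> sets M" using subalg by (auto simp: subalgebra_def)
    have BM [measurable]: "B \<in> sets M" unfolding B_def by measurable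
    have int1: "integrable M (\<lambda>\<omega>. indicat_real C \<omega> * indicat_real S \<omega>)"
      using integrable_mult_indicator[OF CM intS] by simp
    have int2: "integrable M (indicat_real B)"
      by (intro integrable_real_indicator) (auto simp: less_top[symmetric])
    have le: "indicat_real C \<omega> * indicat_real S \<omega> \<le> indicat_real B \<omega>" for \<omega>
      using S[of \<omega>] by (auto simp: indicator_def C_def B_def)
    have "AE \<omega> in M. real_cond_exp M F (\<lambda>\<omega>. indicat_real C \<omega> * indicat_real S \<omega>) \<omega>
        \<le> real_cond_exp M F (indicat_real B) \<omega>"
      using le int1 int2 by (intro real_cond_exp_mono) auto
    moreover have "AE \<omega> in M. real_cond_exp M F (\<lambda>\<omega>. indicat_real C \<omega> * indicat_real S \<omega>) \<omega>
        = indicat_real C \<omega> * p \<omega>"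
      unfolding p_def using int1 by (intro real_cond_exp_mult) auto
    moreover note tail[OF that, folded B_def] AE_space
    ultimately show ?thesis
      by eventually_elim (auto simp: C_def)
  qed
  have "AE \<omega> in M. \<forall>\<alpha>\<in>{\<alpha> \<in> \<rat>. 0 < \<alpha>}. \<alpha> * W \<omega> \<le> Y \<omega> \<longrightarrow> p \<omega> \<le> \<epsilon> / \<alpha> powr r"
    using level by (intro AE_ball_countable'[OF _ countable_subset[OF _ countable_rat]]) auto
  with p_nonneg p_le_1 AE_space show ?thesis
  proof eventually_elim
    case (elim \<omega>)
    note W0 = Wpos[OF elim(3)]
    define \<kappa> where "\<kappa> = \<epsilon> powr (1 / r)"
    have "p \<omega> * (Y \<omega> / W \<omega>) \<le> \<kappa>"
    proof (rule ccontr)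
      assume "\<not> ?thesis"
      then have gt: "\<kappa> < p \<omega> * (Y \<omega> / W \<omega>)" by simp
      have "0 \<le> \<kappa>" by (simp add: \<kappa>_def)
      with gt have "p \<omega> \<noteq> 0" by auto
      with elim(1) have "0 < p \<omega>" by simp
      with gt have lt: "\<kappa> / p \<omega> < Y \<omega> / W \<omega>"
        by (simp add: pos_divide_less_eq mult.commute)
      from Rats_dense_in_real[OF lt] obtain \<alpha> where
        \<alpha>: "\<alpha> \<in> \<rat>" "\<kappa> / p \<omega> < \<alpha>" "\<alpha> < Y \<omega> / W \<omega>" by blast
      have "0 < \<alpha>" using \<alpha>(2) \<open>0 \<le> \<kappa>\<close> \<open>0 < p \<omega>\<close> by (meson divide_nonneg_pos le_less_trans)
      moreover have "\<alpha> * W \<omega> \<le> Y \<omega>" using \<alpha>(3) W0 by (simp add: field_simps)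
      ultimately have "p \<omega> \<le> \<epsilon> / \<alpha> powr r" using elim(4) \<alpha>(1) by auto
      then have "p \<omega> * \<alpha> \<le> \<kappa>"
        unfolding \<kappa>_def using \<open>0 < \<alpha>\<close> elim(2) assms(7,8) by (intro tail_bound_times_level_le)
      with \<alpha>(2) \<open>0 < p \<omega>\<close> show False by (simp add: field_simps)
    qed
    with W0 show ?case by (simp add: p_def \<kappa>_def field_simps)
  qed
qed

section \<open>The history of the algorithm\<close>

lemma space_history [simp]: "space (history M G F Fg k) = space M"
  unfolding history_def by (rule space_measure_of) auto

lemma sets_history:
  "sets (history M G F Fg k) = sigma_sets (space M)
     ({F j -` A \<inter> space M | j A. j < k \<and> A \<in> sets borel} \<union>
      {Fg j -` A \<inter> space M | j A. j < k \<and> A \<in> sets borel} \<union>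
      {G j -` A \<inter> space M | j A. j \<le> k \<and> A \<in> sets borel})"
  unfolding history_def by (rule sets_measure_of) auto

lemma history_measurable_estimates:
  assumes "j < k"
  shows "F j \<in> borel_measurable (history M G F Fg k)"
    and "Fg j \<in> borel_measurable (history M G F Fg k)"
proof -
  have "F j -` A \<inter> space M \<in> sets (history M G F Fg k)"
    and "Fg j -` A \<inter> space M \<in> sets (history M G F Fg k)" if "A \<in> sets borel" for A
    unfolding sets_history
    by (rule sigma_sets.Basic, rule UnI1, use that assms in blast)+
  then show "F j \<in> borel_measurable (history M G F Fg k)"
    and "Fg j \<in> borel_measurable (history M G F Fg k)"
    by (auto intro!: measurableI)
qed

lemma history_measurable_direction:
  assumes "j \<le> k"
  shows "G j \<in> borel_measurable (history M G F Fg k)"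
  using assms by (auto intro!: measurableI sigma_sets.Basic simp: sets_history)

lemma subalgebra_history:
  assumes "\<And>k. F k \<in> borel_measurable M" "\<And>k. Fg k \<in> borel_measurable M"
    and "\<And>k. G k \<in> borel_measurable M"
  shows "subalgebra M (history M G F Fg k)"
  unfolding subalgebra_def sets_history
  using assms by (auto intro!: sets.sigma_sets_subset intro: measurable_sets)

section \<open>Measurability and boundedness of the iterates\<close>

context stochastic_direct_search
begin

abbreviation hist :: "nat \<Rightarrow> 'w measure" where
  "hist k \<equiv> history M G F Fg k"

lemma finite_measure_subalgebra_hist: "finite_measure_subalgebra M (hist k)"
  using subalgebra_history[OF F_measurable Fg_measurable G_measurable]
  by unfold_locales auto

text \<open>
  The point and the step size of iteration \<open>k\<close> are determined by earlier directions and
  estimates, so they count as known when conditioning on the history of that iteration.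
\<close>

lemma iterates_measurable_hist:
  assumes "k \<le> m"
  shows "X k \<in> borel_measurable (hist m) \<and> \<Delta> k \<in> borel_measurable (hist m)"
  using assms
proof (induction k)
  case 0
  have "X 0 \<in> borel_measurable (hist m) \<longleftrightarrow> (\<lambda>_. x0) \<in> borel_measurable (hist m)"
    and "\<Delta> 0 \<in> borel_measurable (hist m) \<longleftrightarrow> (\<lambda>_. \<delta>0) \<in> borel_measurable (hist m)"
    by (intro measurable_cong; simp add: X_0 \<Delta>_0)+
  then show ?case by simp
next
  case (Suc k)
  then have [measurable]: "X k \<in> borel_measurable (hist m)" "\<Delta> k \<in> borel_measurable (hist m)"
    by auto
  have [measurable]: "F k \<in> borel_measurable (hist m)" "Fg k \<in> borel_measurable (hist m)"
    "G k \<in> borel_measurable (hist m)"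
    using Suc.prems by (auto intro: history_measurable_estimates history_measurable_direction)
  have "(\<lambda>\<omega>. if F k \<omega> - Fg k \<omega> \<ge> \<theta> * \<Delta> k \<omega> powr q
      then X k \<omega> + \<Delta> k \<omega> *\<^sub>R G k \<omega> else X k \<omega>) \<in> borel_measurable (hist m)"
    by measurable
  moreover have "(\<lambda>\<omega>. if F k \<omega> - Fg k \<omega> \<ge> \<theta> * \<Delta> k \<omega> powr q
      then \<tau>bar * \<Delta> k \<omega> else (1 - \<tau>) * \<Delta> k \<omega>) \<in> borel_measurable (hist m)"
    by measurable
  moreover have "X (Suc k) \<in> borel_measurable (hist m) \<longleftrightarrow>
    (\<lambda>\<omega>. if F k \<omega> - Fg k \<omega> \<ge> \<theta> * \<Delta> k \<omega> powr q
      then X k \<omega> + \<Delta> k \<omega> *\<^sub>R G k \<omega> else X k \<omega>) \<in> borel_measurable (hist m)"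
    by (rule measurable_cong) (simp add: X_Suc)
  moreover have "\<Delta> (Suc k) \<in> borel_measurable (hist m) \<longleftrightarrow>
    (\<lambda>\<omega>. if F k \<omega> - Fg k \<omega> \<ge> \<theta> * \<Delta> k \<omega> powr q
      then \<tau>bar * \<Delta> k \<omega> else (1 - \<tau>) * \<Delta> k \<omega>) \<in> borel_measurable (hist m)"
    by (rule measurable_cong) (simp add: \<Delta>_Suc)
  ultimately show ?case by blast
qed

lemma iterates_measurable [measurable]:
  "X k \<in> borel_measurable M" "\<Delta> k \<in> borel_measurable M"
  using iterates_measurable_hist[OF order.refl, of k]
    measurable_from_subalg[OF subalgebra_history[of F M Fg G k,
      OF F_measurable Fg_measurable G_measurable]]
  by blast+

lemma \<Delta>_pos: "\<omega> \<in> space M \<Longrightarrow> 0 < \<Delta> k \<omega>"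
  using \<tau>_range \<tau>bar_range \<delta>0_pos by (induction k) (auto simp: \<Delta>_0 \<Delta>_Suc)

lemma \<Delta>_le:
  assumes "\<omega> \<in> space M"
  shows "\<Delta> k \<omega> \<le> \<tau>bar ^ k * \<delta>0"
proof (induction k)
  case 0
  show ?case using assms by (simp add: \<Delta>_0)
next
  case (Suc k)
  have "\<Delta> (Suc k) \<omega> \<le> \<tau>bar * \<Delta> k \<omega>"
    using assms \<Delta>_pos[OF assms, of k] \<tau>_range \<tau>bar_range
    by (auto simp: \<Delta>_Suc intro!: mult_right_mono)
  also have "\<dots> \<le> \<tau>bar * (\<tau>bar ^ k * \<delta>0)"
    using Suc \<tau>bar_range by (intro mult_left_mono) auto
  finally show ?case by (simp add: mult_ac)
qed

lemma norm_X_bounded: "\<exists>R. \<forall>\<omega>\<in>space M. norm (X k \<omega>) \<le> R"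
proof (induction k)
  case 0
  show ?case by (auto simp: X_0)
next
  case (Suc k)
  then obtain R where R: "\<And>\<omega>. \<omega> \<in> space M \<Longrightarrow> norm (X k \<omega>) \<le> R" by blast
  have "norm (X (Suc k) \<omega>) \<le> R + \<tau>bar ^ k * \<delta>0" if w: "\<omega> \<in> space M" for \<omega>
  proof -
    have "norm (\<Delta> k \<omega> *\<^sub>R G k \<omega>) \<le> \<tau>bar ^ k * \<delta>0"
      using G_sphere[OF w] \<Delta>_pos[OF w] \<Delta>_le[OF w] by (simp add: less_imp_le)
    moreover have "0 \<le> \<tau>bar ^ k * \<delta>0"
      using \<Delta>_pos[OF w, of k] \<Delta>_le[OF w, of k] by linarith
    ultimately show ?thesis
      using R[OF w] norm_triangle_ineq[of "X k \<omega>" "\<Delta> k \<omega> *\<^sub>R G k \<omega>"]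
      by (auto simp: X_Suc w)
  qed
  then show ?case by blast
qed

lemma integrable_\<Delta>_powr: "integrable M (\<lambda>\<omega>. \<Delta> k \<omega> powr q)"
proof (rule integrable_const_bound[where B = "(\<tau>bar ^ k * \<delta>0) powr q"])
  show "AE \<omega> in M. norm (\<Delta> k \<omega> powr q) \<le> (\<tau>bar ^ k * \<delta>0) powr q"
    using \<Delta>_pos \<Delta>_le q_gt_1 by (auto intro!: powr_mono2 simp: less_imp_le)
qed simp

lemma integrable_continuous_bounded:
  fixes f :: "real ^ 'n \<Rightarrow> real"
  assumes f: "continuous_on UNIV f" and [measurable]: "Z \<in> borel_measurable M"
    and Z: "\<And>\<omega>. \<omega> \<in> space M \<Longrightarrow> norm (Z \<omega>) \<le> R"
  shows "integrable M (\<lambda>\<omega>. f (Z \<omega>))"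
proof -
  have [measurable]: "f \<in> borel_measurable borel"
    using f by (rule borel_measurable_continuous_onI)
  have "bounded (f ` cball 0 R)"
    using f by (intro compact_imp_bounded compact_continuous_image)
      (auto intro: continuous_on_subset)
  then obtain B where "\<forall>y\<in>f ` cball 0 R. norm y \<le> B" unfolding bounded_iff by blast
  with Z show ?thesis
    by (intro integrable_const_bound[where B = B]) (auto simp: AE_I2)
qed

section \<open>Expected decrease of the Lyapunov function\<close>

abbreviation success :: "nat \<Rightarrow> 'w set" where
  "success k \<equiv> {\<omega> \<in> space M. F k \<omega> - Fg k \<omega> \<ge> \<theta> * \<Delta> k \<omega> powr q}"

text \<open>
  On a success the step size term changes by \<open>\<nu> (\<tau>bar\<^sup>q - 1) \<Delta>\<^sup>q\<close>, which is at most
  \<open>\<nu> tau_plus \<Delta>\<^sup>q = (\<theta> - \<nu> tau_minus) \<Delta>\<^sup>q\<close> when \<open>\<nu> = \<theta> / tau_total\<close>; the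
  factor of the indicator is what remains once the true decrease of \<open>f\<close> is subtracted.
\<close>

lemma lyapunov_step_le:
  fixes f :: "real ^ 'n \<Rightarrow> real"
  assumes w: "\<omega> \<in> space M" and \<nu>: "\<nu> \<ge> 0" "\<nu> * tau_total \<tau> q = \<theta>"
  shows "f (X (Suc k) \<omega>) + \<nu> * \<Delta> (Suc k) \<omega> powr q \<le>
    f (X k \<omega>) + \<nu> * \<Delta> k \<omega> powr q
    + indicat_real (success k) \<omega> *
        (\<theta> * \<Delta> k \<omega> powr q - (f (X k \<omega>) - f (X k \<omega> + \<Delta> k \<omega> *\<^sub>R G k \<omega>)))
    - \<nu> * tau_minus \<tau> q * \<Delta> k \<omega> powr q"
proof (cases "\<omega> \<in> success k")
  case True
  let ?d = "\<Delta> k \<omega> powr q"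
  have "\<tau>bar powr q \<le> (1 + \<tau>) powr q"
    using \<tau>bar_range q_gt_1 by (intro powr_mono2) auto
  then have "\<nu> * \<tau>bar powr q * ?d \<le> \<nu> * (1 + \<tau>) powr q * ?d"
    using \<nu>(1) by (intro mult_right_mono mult_left_mono) auto
  also have "\<dots> = \<nu> * ?d + \<theta> * ?d - \<nu> * tau_minus \<tau> q * ?d"
    unfolding \<nu>(2)[symmetric] by (simp add: tau_total_def tau_plus_def algebra_simps)
  finally have "\<nu> * \<tau>bar powr q * ?d \<le> \<nu> * ?d + \<theta> * ?d - \<nu> * tau_minus \<tau> q * ?d" .
  moreover have "\<Delta> (Suc k) \<omega> powr q = \<tau>bar powr q * ?d"
    using True \<tau>bar_range \<Delta>_pos[OF w, of k] by (simp add: \<Delta>_Suc powr_mult)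
  ultimately show ?thesis using True by (simp add: X_Suc)
next
  case False
  then have "\<Delta> (Suc k) \<omega> powr q = (1 - \<tau>) powr q * \<Delta> k \<omega> powr q"
    using w \<tau>_range \<Delta>_pos[OF w, of k] by (simp add: \<Delta>_Suc powr_mult)
  then show ?thesis
    using False w by (simp add: X_Suc tau_minus_def algebra_simps)
qed

text \<open>
  In the bound of the previous lemma only the success indicator is random given the history.
  It may therefore be replaced, under the integral, by its conditional probability, and the
  random-threshold estimate applies with \<open>Y\<close> as the threshold.
\<close>

lemma expected_lyapunov_decrease:
  fixes f :: "real ^ 'n \<Rightarrow> real"
  assumes f: "continuous_on UNIV f" and \<epsilon>: "0 < \<epsilon>"
    and \<nu>: "\<nu> \<ge> 0" "\<nu> * tau_total \<tau> q = \<theta>"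
    and tail: "\<And>\<alpha>. 0 < \<alpha> \<Longrightarrow> AE \<omega> in M. real_cond_exp M (hist k)
      (indicat_real {\<omega> \<in> space M.
         \<bar>F k \<omega> - Fg k \<omega> - (f (X k \<omega>) - f (X k \<omega> + \<Delta> k \<omega> *\<^sub>R G k \<omega>))\<bar>
           \<ge> \<alpha> * \<Delta> k \<omega> powr q}) \<omega>
      \<le> \<epsilon> / \<alpha> powr (conj_exponent q)"
  shows "(\<nu> * tau_minus \<tau> q - \<epsilon> powr (1 / conj_exponent q)) * (\<integral>\<omega>. \<Delta> k \<omega> powr q \<partial>M) \<le>
    (\<integral>\<omega>. f (X k \<omega>) + \<nu> * \<Delta> k \<omega> powr q \<partial>M) -
    (\<integral>\<omega>. f (X (Suc k) \<omega>) + \<nu> * \<Delta> (Suc k) \<omega> powr q \<partial>M)"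
proof -
  interpret sub: finite_measure_subalgebra M "hist k" by (rule finite_measure_subalgebra_hist)
  define \<kappa> where "\<kappa> = \<epsilon> powr (1 / conj_exponent q)"
  define D where "D \<omega> = f (X k \<omega>) - f (X k \<omega> + \<Delta> k \<omega> *\<^sub>R G k \<omega>)" for \<omega>
  define Y where "Y \<omega> = \<theta> * \<Delta> k \<omega> powr q - D \<omega>" for \<omega>
  define p where "p = real_cond_exp M (hist k) (indicat_real (success k))"
  note [measurable] = F_measurable Fg_measurable G_measurable
  have [measurable]: "f \<in> borel_measurable borel"
    using f by (rule borel_measurable_continuous_onI)
  have hX [measurable]: "X k \<in> borel_measurable (hist k)" "\<Delta> k \<in> borel_measurable (hist k)"
    using iterates_measurable_hist[of k k] by auto
  have hG [measurable]: "G k \<in> borel_measurable (hist k)"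
    by (simp add: history_measurable_direction)
  have hY [measurable]: "Y \<in> borel_measurable (hist k)"
    unfolding Y_def D_def by measurable
  have SM [measurable]: "success k \<in> sets M" by measurable

  have int\<Delta>: "integrable M (\<lambda>\<omega>. \<Delta> j \<omega> powr q)" for j by (rule integrable_\<Delta>_powr)
  have intf: "integrable M (\<lambda>\<omega>. f (X j \<omega>))" for j
    using norm_X_bounded[of j] f by (auto intro: integrable_continuous_bounded)
  have intfG: "integrable M (\<lambda>\<omega>. f (X k \<omega> + \<Delta> k \<omega> *\<^sub>R G k \<omega>))"
  proof -
    obtain R where R: "\<And>\<omega>. \<omega> \<in> space M \<Longrightarrow> norm (X k \<omega>) \<le> R" using norm_X_bounded by blast
    have "norm (X k \<omega> + \<Delta> k \<omega> *\<^sub>R G k \<omega>) \<le> R + \<tau>bar ^ k * \<delta>0" if w: "\<omega> \<in> space M" for \<omega>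
      using R[OF w] G_sphere[OF w] \<Delta>_pos[OF w, of k] \<Delta>_le[OF w, of k]
      by (intro norm_triangle_le add_mono) (simp_all add: less_imp_le)
    then show ?thesis by (intro integrable_continuous_bounded[OF f]) auto
  qed
  have intY: "integrable M Y"
    unfolding Y_def D_def using int\<Delta> intf intfG by (intro Bochner_Integration.integrable_diff) auto
  have intYS: "integrable M (\<lambda>\<omega>. Y \<omega> * indicat_real (success k) \<omega>)"
    using integrable_mult_indicator[OF SM intY] by (simp add: mult.commute)

  have "AE \<omega> in M. p \<omega> * Y \<omega> \<le> \<kappa> * \<Delta> k \<omega> powr q"
    unfolding p_def \<kappa>_def
  proof (rule sub.cond_prob_times_threshold_le[where e = "\<lambda>\<omega>. F k \<omega> - Fg k \<omega> - D \<omega>"])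
    show "(\<lambda>\<omega>. F k \<omega> - Fg k \<omega> - D \<omega>) \<in> borel_measurable M"
      unfolding D_def by measurable
    show "0 < \<Delta> k \<omega> powr q" if "\<omega> \<in> space M" for \<omega>
      using \<Delta>_pos[OF that, of k] by simp
    show "1 \<le> conj_exponent q" using q_gt_1 by (simp add: conj_exponent_def field_simps)
  qed (use tail \<epsilon> in \<open>auto simp: D_def Y_def\<close>)
  moreover have "integrable M (\<lambda>\<omega>. Y \<omega> * p \<omega>)"
    and tower: "(\<integral>\<omega>. Y \<omega> * p \<omega> \<partial>M) = (\<integral>\<omega>. Y \<omega> * indicat_real (success k) \<omega> \<partial>M)"
    unfolding p_def by (rule sub.real_cond_exp_intg[OF intYS hY]; measurable)+
  ultimately have "(\<integral>\<omega>. Y \<omega> * p \<omega> \<partial>M) \<le> (\<integral>\<omega>. \<kappa> * \<Delta> k \<omega> powr q \<partial>M)"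
    using int\<Delta> by (intro integral_mono_AE) (auto simp: mult.commute)
  then have YS: "(\<integral>\<omega>. Y \<omega> * indicat_real (success k) \<omega> \<partial>M) \<le> \<kappa> * (\<integral>\<omega>. \<Delta> k \<omega> powr q \<partial>M)"
    using tower by simp

  have "(\<integral>\<omega>. f (X (Suc k) \<omega>) + \<nu> * \<Delta> (Suc k) \<omega> powr q \<partial>M) \<le>
    (\<integral>\<omega>. f (X k \<omega>) + \<nu> * \<Delta> k \<omega> powr q + Y \<omega> * indicat_real (success k) \<omega>
       - \<nu> * tau_minus \<tau> q * \<Delta> k \<omega> powr q \<partial>M)"
    using lyapunov_step_le[OF _ \<nu>, of _ f k] int\<Delta> intf intYS
    by (intro integral_mono Bochner_Integration.integrable_diff
        Bochner_Integration.integrable_add) (auto simp: Y_def D_def mult.commute)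
  also have "\<dots> = (\<integral>\<omega>. f (X k \<omega>) + \<nu> * \<Delta> k \<omega> powr q \<partial>M)
      + (\<integral>\<omega>. Y \<omega> * indicat_real (success k) \<omega> \<partial>M)
      - \<nu> * tau_minus \<tau> q * (\<integral>\<omega>. \<Delta> k \<omega> powr q \<partial>M)"
    using int\<Delta> intf intYS by simp
  finally show ?thesis using YS by (simp add: \<kappa>_def algebra_simps)
qed

end

section \<open>Summability of the expected step sizes\<close>

lemma locally_lipschitz_imp_continuous_on:
  assumes "locally_lipschitz f"
  shows "continuous_on UNIV f"
proof (rule continuous_at_imp_continuous_on, intro ballI)
  fix x
  from assms obtain u L where "0 < u" "L-lipschitz_on (ball x u) f"
    unfolding locally_lipschitz_def by blast
  then have "continuous_on (ball x u) f" by (blast intro: lipschitz_on_continuous_on)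
  then show "isCont f x" using \<open>0 < u\<close> continuous_on_interior by fastforce
qed

lemma summable_telescoping_bound:
  fixes a \<Phi> :: "nat \<Rightarrow> real"
  assumes "0 < c" "\<And>k. 0 \<le> a k" "\<And>k. c * a k \<le> \<Phi> k - \<Phi> (Suc k)" "\<And>k. L \<le> \<Phi> k"
  shows "summable a"
proof (rule bounded_imp_summable)
  fix n
  have "c * (\<Sum>k\<le>n. a k) \<le> (\<Sum>k\<le>n. \<Phi> k - \<Phi> (Suc k))"
    unfolding sum_distrib_left by (intro sum_mono assms)
  also have "\<dots> = \<Phi> 0 - \<Phi> (Suc n)" by (rule sum_telescope)
  also have "\<dots> \<le> \<Phi> 0 - L" using assms(4)[of "Suc n"] by simp
  finally show "(\<Sum>k\<le>n. a k) \<le> (\<Phi> 0 - L) / c"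
    using assms(1) by (simp add: field_simps)
qed (rule assms)

theorem theorem3p1:
  fixes M :: "'w measure"
    and f :: "real ^ 'n \<Rightarrow> real"
    and x0 :: "real ^ 'n"
    and \<delta>0 \<theta> q \<tau> \<tau>bar \<epsilon> :: real
    and G X :: "nat \<Rightarrow> 'w \<Rightarrow> real ^ 'n"
    and F Fg \<Delta> :: "nat \<Rightarrow> 'w \<Rightarrow> real"
  assumes "locally_lipschitz f"
    and "bdd_below (range f)"
    and "stochastic_direct_search M x0 \<delta>0 \<theta> q \<tau> \<tau>bar G F Fg X \<Delta>"
    and "\<epsilon> > 0"
    and "\<And>k \<alpha>. \<alpha> > 0 \<Longrightarrow>
      AE \<omega> in M.
        real_cond_exp M (history M G F Fg k)
          (indicat_real {\<omega> \<in> space M.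
             \<bar>F k \<omega> - Fg k \<omega> - (f (X k \<omega>) - f (X k \<omega> + \<Delta> k \<omega> *\<^sub>R G k \<omega>))\<bar>
               \<ge> \<alpha> * \<Delta> k \<omega> powr q}) \<omega>
        \<le> \<epsilon> / \<alpha> powr (q / (q - 1))"
    and "\<theta> > \<epsilon> powr (1 / conj_exponent q) * tau_total \<tau> q / tau_minus \<tau> q"
  shows "(\<forall>k. integrable M (\<lambda>\<omega>. \<Delta> k \<omega> powr q)) \<and>
    summable (\<lambda>k. \<integral>\<omega>. \<Delta> k \<omega> powr q \<partial>M)"
proof -
  interpret stochastic_direct_search M x0 \<delta>0 \<theta> q \<tau> \<tau>bar G F Fg X \<Delta> by fact
  have cont: "continuous_on UNIV f"
    using assms(1) by (rule locally_lipschitz_imp_continuous_on)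
  obtain L where L: "\<And>x. L \<le> f x" using assms(2) by (auto simp: bdd_below_def)
  have "(1 - \<tau>) powr q < 1" "1 \<le> (1 + \<tau>) powr q"
    using \<tau>_range q_gt_1 powr_less_mono2[of q "1 - \<tau>" 1]
    by (auto intro: ge_one_powr_ge_zero)
  then have tau: "0 < tau_minus \<tau> q" "0 < tau_total \<tau> q"
    by (auto simp: tau_minus_def tau_plus_def tau_total_def)
  define \<nu> where "\<nu> = \<theta> / tau_total \<tau> q"
  have \<nu>: "\<nu> \<ge> 0" "\<nu> * tau_total \<tau> q = \<theta>" using tau \<theta>_pos by (auto simp: \<nu>_def)
  define c where "c = \<nu> * tau_minus \<tau> q - \<epsilon> powr (1 / conj_exponent q)"
  have "0 < c"
    using assms(6) tau by (simp add: c_def \<nu>_def field_simps)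
  have int\<Phi>: "integrable M (\<lambda>\<omega>. f (X k \<omega>) + \<nu> * \<Delta> k \<omega> powr q)" for k
    using norm_X_bounded[of k] cont integrable_\<Delta>_powr[of k]
    by (auto intro!: Bochner_Integration.integrable_add intro: integrable_continuous_bounded)
  have "summable (\<lambda>k. \<integral>\<omega>. \<Delta> k \<omega> powr q \<partial>M)"
  proof (rule summable_telescoping_bound[OF \<open>0 < c\<close>])
    show "c * (\<integral>\<omega>. \<Delta> k \<omega> powr q \<partial>M) \<le>
      (\<integral>\<omega>. f (X k \<omega>) + \<nu> * \<Delta> k \<omega> powr q \<partial>M) -
      (\<integral>\<omega>. f (X (Suc k) \<omega>) + \<nu> * \<Delta> (Suc k) \<omega> powr q \<partial>M)" for k
      unfolding c_def
      by (rule expected_lyapunov_decrease[OF cont assms(4) \<nu>])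
        (use assms(5) in \<open>simp add: conj_exponent_def\<close>)
    show "L \<le> (\<integral>\<omega>. f (X k \<omega>) + \<nu> * \<Delta> k \<omega> powr q \<partial>M)" for k
      using \<nu>(1) by (intro integral_ge_const int\<Phi>) (auto intro!: AE_I2 add_increasing2 L)
  qed auto
  with integrable_\<Delta>_powr show ?thesis by blast
qed

end
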